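(* Let $\mathbb{MSE}_{t,s}=\sum_{r=s+1}^{t}\xi_q^2(t,r)\sigma^2(r)$, $s<t$, be the mean square forecasting error of a TV-ARMA($p,q$) model with deterministic coefficients. If there is a real $C>1$ such that $\sum_{r=-\infty}^{t}|\xi(t,r)|\le C<\infty$ for all $t$, that is, the function $F(t)=\sum_{r=-\infty}^{t}|\xi(t,r)|$ is bounded in $t$, then $\mathbb{MSE}_{t,s}$ is uniformly bounded (in $t$ and $s$).
   Context: Consider the TV-ARMA($p,q$) equation ($p,q\ge1$) with deterministic coefficients $y_t=\varphi(t)+\sum_{m=1}^{p}\phi_m(t)y_{t-m}+\varepsilon_t+\sum_{l=1}^{q}\theta_l(t)\varepsilon_{t-l}$, $t\in\mathbb{Z}$, where $\mathbb{E}(\varepsilon_t)=0$, $\mathbb{E}(\varepsilon_t\varepsilon_s)=0$ for $s\ne t$, $\mathbb{E}(\varepsilon_t\mid y_s,s<t)=0$, $\mathbb{E}(\varepsilon_t^2)=\sigma^2(t)$, $0<\sigma^2(t)\le M<\infty$. Standing assumption of the forecasting setting: $\varphi(t)$ and $\theta_l(t)$ ($1\le l\le q$) are bounded in $t$. For integers $s<t$, $\xi(t,s)=\det(\mathbf{\Phi}_{t,s})$, where $\mathbf{\Phi}_{t,s}$ is the $(t-s)\times(t-s)$ matrix whose $(i,j)$ entry is $\phi_{i-j+1}(s+i)$ if $0\le i-j\le p-1$, $-1$ if $j=i+1$, and $0$ otherwise; $\xi(t,t)=1$ and $\xi(t,s)=0$ for $t<s$. Also $\xi_q(t,r)=\xi(t,r)+\sum_{l=1}^{q}\xi(t,r+l)\theta_l(r+l)$.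 $\mathbb{MSE}_{t,s}$ is the variance of the forecast error $\sum_{r=s+1}^{t}\xi_q(t,r)\varepsilon_r$ of the optimal linear predictor of $y_t$ at time $s<t$. *)

theory Defs
  imports "HOL-Probability.Probability" "Jordan_Normal_Form.Determinant"
begin

(* The functions phi and theta are only ever consulted at the indices 1..p and 1..q.
   Matrices are 0-indexed here, so the 1-indexed entry (i, j) is found at (i - 1, j - 1);
   the difference of the indices is unaffected, and s + i becomes s + i + 1.
   The coefficient indices are subtracted as naturals, which is harmless because of the
   guard j \<le> i. *)
definition coeff_mat :: "nat \<Rightarrow> (nat \<Rightarrow> int \<Rightarrow> real) \<Rightarrow> int \<Rightarrow> int \<Rightarrow> real mat" where
  "coeff_mat p phi t s = mat (nat (t - s)) (nat (t - s)) (\<lambda>(i, j).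
     if j \<le> i \<and> i - j \<le> p - 1 then phi (i - j + 1) (s + int i + 1)
     else if j = i + 1 then -1
     else 0)"

definition xi :: "nat \<Rightarrow> (nat \<Rightarrow> int \<Rightarrow> real) \<Rightarrow> int \<Rightarrow> int \<Rightarrow> real" where
  "xi p phi t s =
     (if t < s then 0 else if t = s then 1 else Determinant.det (coeff_mat p phi t s))"

definition xi_q ::
  "nat \<Rightarrow> nat \<Rightarrow> (nat \<Rightarrow> int \<Rightarrow> real) \<Rightarrow> (nat \<Rightarrow> int \<Rightarrow> real) \<Rightarrow> int \<Rightarrow> int \<Rightarrow> real" where
  "xi_q p q phi theta t r =
     xi p phi t r + (\<Sum>l = 1..q. xi p phi t (r + int l) * theta l (r + int l))"

definition strict_past :: "'a measure \<Rightarrow> (int \<Rightarrow> 'a \<Rightarrow> real) \<Rightarrow> int \<Rightarrow> 'a measure" where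
  "strict_past M y t =
     sigma (space M) {y s -` A \<inter> space M |s A. s < t \<and> A \<in> sets borel}"

(* Equalities between random variables are understood almost surely. *)
locale tv_arma = prob_space M
  for M :: "'a measure" +
  fixes p q :: nat
    and drift :: "int \<Rightarrow> real"
    and phi theta :: "nat \<Rightarrow> int \<Rightarrow> real"
    and sigma2 :: "int \<Rightarrow> real"
    and y eps :: "int \<Rightarrow> 'a \<Rightarrow> real"
  assumes p_pos: "p \<ge> 1" and q_pos: "q \<ge> 1"
    and y_measurable: "\<And>t. random_variable borel (y t)"
    and eps_measurable: "\<And>t. random_variable borel (eps t)"
    and arma_eq: "\<And>t. AE \<omega> in M. y t \<omega> =
          drift t + (\<Sum>m = 1..p. phi m t * y (t - int m) \<omega>)
          + eps t \<omega> + (\<Sum>l = 1..q. theta l t * eps (t - int l) \<omega>)"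
    and eps_integrable: "\<And>t. integrable M (eps t)"
    and eps_square_integrable: "\<And>t. integrable M (\<lambda>\<omega>. (eps t \<omega>)\<^sup>2)"
    and eps_mean: "\<And>t. expectation (eps t) = 0"
    and eps_uncorrelated: "\<And>t s. s \<noteq> t \<Longrightarrow> expectation (\<lambda>\<omega>. eps t \<omega> * eps s \<omega>) = 0"
    and eps_cond_mean: "\<And>t. AE \<omega> in M. real_cond_exp M (strict_past M y t) (eps t) \<omega> = 0"
    and eps_variance: "\<And>t. expectation (\<lambda>\<omega>. (eps t \<omega>)\<^sup>2) = sigma2 t"
    and sigma2_pos: "\<And>t. 0 < sigma2 t"
    and sigma2_bounded: "\<exists>K. \<forall>t. sigma2 t \<le> K"
    and drift_bounded: "bounded (range drift)"
    and theta_bounded: "\<And>l. l \<in> {1..q} \<Longrightarrow> bounded (range (theta l))"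

definition forecast_error ::
  "nat \<Rightarrow> nat \<Rightarrow> (nat \<Rightarrow> int \<Rightarrow> real) \<Rightarrow> (nat \<Rightarrow> int \<Rightarrow> real) \<Rightarrow> (int \<Rightarrow> 'a \<Rightarrow> real)
    \<Rightarrow> int \<Rightarrow> int \<Rightarrow> 'a \<Rightarrow> real" where
  "forecast_error p q phi theta eps t s \<omega> = (\<Sum>r = s + 1..t. xi_q p q phi theta t r * eps r \<omega>)"

definition MSE ::
  "'a measure \<Rightarrow> nat \<Rightarrow> nat \<Rightarrow> (nat \<Rightarrow> int \<Rightarrow> real) \<Rightarrow> (nat \<Rightarrow> int \<Rightarrow> real)
    \<Rightarrow> (int \<Rightarrow> 'a \<Rightarrow> real) \<Rightarrow> int \<Rightarrow> int \<Rightarrow> real" where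
  "MSE M p q phi theta eps t s = prob_space.variance M (forecast_error p q phi theta eps t s)"

end

theory Submission
  imports Defs
begin

text \<open>The forecast error is a finite linear combination of centred, uncorrelated noise terms,
  so its variance is the weighted sum of squares in \<open>MSE_eq\<close>; this rests on
  \<open>variance_sum_uncorrelated\<close>. The weights \<open>sigma2 r\<close> have a common upper
  bound, and a sum of squares is at most the square of the sum of absolute values, so it suffices to
  bound the l1 norm of \<open>xi_q\<close> in its second time argument, uniformly in
  \<open>t\<close>. Since \<open>xi_q\<close> is \<open>xi\<close> plus finitely many translates of
  \<open>xi\<close> multiplied by bounded coefficients, \<open>sum_abs_xi_q_le\<close> derives this
  from the assumed l1 bound on \<open>xi\<close>.\<close>

lemma (in prob_space) variance_sum_uncorrelated:
  fixes X :: "'i \<Rightarrow> 'a \<Rightarrow> real"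
  assumes meas: "\<And>i. i \<in> I \<Longrightarrow> X i \<in> borel_measurable M"
    and sq: "\<And>i. i \<in> I \<Longrightarrow> integrable M (\<lambda>\<omega>. (X i \<omega>)\<^sup>2)"
    and mean: "\<And>i. i \<in> I \<Longrightarrow> expectation (X i) = 0"
    and uncorr: "\<And>i j. i \<in> I \<Longrightarrow> j \<in> I \<Longrightarrow> i \<noteq> j \<Longrightarrow> expectation (\<lambda>\<omega>. X i \<omega> * X j \<omega>) = 0"
    and fin: "finite I"
  shows "variance (\<lambda>\<omega>. \<Sum>i\<in>I. c i * X i \<omega>) = (\<Sum>i\<in>I. (c i)\<^sup>2 * expectation (\<lambda>\<omega>. (X i \<omega>)\<^sup>2))"
proof -
  \<comment> \<open>Cross terms are dominated by the sum of the two squares; their integrability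
    lets the expectation pass through the double sum below.\<close>
  have prod: "integrable M (\<lambda>\<omega>. X i \<omega> * X j \<omega>)" if "i \<in> I" "j \<in> I" for i j
  proof (rule Bochner_Integration.integrable_bound)
    show "integrable M (\<lambda>\<omega>. (X i \<omega>)\<^sup>2 + (X j \<omega>)\<^sup>2)"
      using sq that by auto
    show "(\<lambda>\<omega>. X i \<omega> * X j \<omega>) \<in> borel_measurable M"
      using meas that by auto
    have "\<bar>a * b\<bar> \<le> a\<^sup>2 + b\<^sup>2" for a b :: real
      using sum_squares_bound[of "\<bar>a\<bar>" "\<bar>b\<bar>"] abs_ge_zero[of "a * b"]
      unfolding abs_mult power2_abs by linarith
    then show "AE \<omega> in M. norm (X i \<omega> * X j \<omega>) \<le> norm ((X i \<omega>)\<^sup>2 + (X j \<omega>)\<^sup>2)"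
      by simp
  qed
  have "integrable M (X i)" if "i \<in> I" for i
    using square_integrable_imp_integrable[OF meas[OF that] sq[OF that]] .
  \<comment> \<open>With mean zero, the variance is the second moment, which expands into a double
    sum.\<close>
  then have "expectation (\<lambda>\<omega>. \<Sum>i\<in>I. c i * X i \<omega>) = 0"
    using mean by (subst Bochner_Integration.integral_sum) auto
  then have "variance (\<lambda>\<omega>. \<Sum>i\<in>I. c i * X i \<omega>)
      = expectation (\<lambda>\<omega>. \<Sum>i\<in>I. \<Sum>j\<in>I. (c i * c j) * (X i \<omega> * X j \<omega>))"
    by (simp add: power2_eq_square sum_product algebra_simps)
  also have "\<dots> = (\<Sum>i\<in>I. \<Sum>j\<in>I. (c i * c j) * expectation (\<lambda>\<omega>. X i \<omega> * X j \<omega>))"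
    using prod by (subst Bochner_Integration.integral_sum; (auto intro!: Bochner_Integration.integrable_sum sum.cong)?)+
  also have "\<dots> = (\<Sum>i\<in>I. \<Sum>j\<in>I. if i = j then (c i)\<^sup>2 * expectation (\<lambda>\<omega>. (X i \<omega>)\<^sup>2) else 0)"
    by (intro sum.cong refl) (auto simp: uncorr power2_eq_square)
  also have "\<dots> = (\<Sum>i\<in>I. (c i)\<^sup>2 * expectation (\<lambda>\<omega>. (X i \<omega>)\<^sup>2))"
    using fin by (simp add: sum.delta)
  finally show ?thesis .
qed

text \<open>The l2 norm is at most the l1 norm; square both sides.\<close>

lemma sum_squares_le_square_sum_abs:
  fixes f :: "'i \<Rightarrow> real"
  shows "(\<Sum>i\<in>I. (f i)\<^sup>2) \<le> (\<Sum>i\<in>I. \<bar>f i\<bar>)\<^sup>2"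
  using power_mono[OF L2_set_le_sum_abs[of f I] L2_set_nonneg, of 2]
  by (simp add: L2_set_def sum_nonneg)

text \<open>Indices of \<open>F\<close> beyond \<open>t\<close> contribute nothing, because
  \<open>xi p phi t r\<close> vanishes for \<open>t < r\<close>. Allowing them matters later, when
  index sets are translated past \<open>t\<close>.\<close>

lemma sum_abs_xi_le:
  assumes "(\<lambda>r. \<bar>xi p phi t r\<bar>) summable_on {..t}" and "finite F"
  shows "(\<Sum>r\<in>F. \<bar>xi p phi t r\<bar>) \<le> (\<Sum>\<^sub>\<infinity>r\<in>{..t}. \<bar>xi p phi t r\<bar>)"
proof -
  have "(\<Sum>r\<in>F. \<bar>xi p phi t r\<bar>) = (\<Sum>r\<in>F \<inter> {..t}. \<bar>xi p phi t r\<bar>)"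
    using assms(2) by (intro sum.mono_neutral_right) (auto simp: xi_def)
  also have "\<dots> \<le> (\<Sum>\<^sub>\<infinity>r\<in>{..t}. \<bar>xi p phi t r\<bar>)"
    using assms by (intro finite_sum_le_infsum) auto
  finally show ?thesis .
qed

text \<open>A translate of a finite set is finite, so the bound \<open>C\<close>, available for
  every finite set, also covers each shifted sum of \<open>xi\<close>. The \<open>l\<close>-th
  moving-average term thus costs at most \<open>C * b l\<close>.\<close>

lemma sum_abs_xi_q_le:
  assumes xi: "\<And>F. finite F \<Longrightarrow> (\<Sum>r\<in>F. \<bar>xi p phi t r\<bar>) \<le> C"
    and theta: "\<And>l r. l \<in> {1..q} \<Longrightarrow> \<bar>theta l r\<bar> \<le> b l"
    and "finite F"
  shows "(\<Sum>r\<in>F. \<bar>xi_q p q phi theta t r\<bar>) \<le> C * (1 + (\<Sum>l = 1..q. b l))"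
proof -
  have "(\<Sum>r\<in>F. \<bar>xi_q p q phi theta t r\<bar>)
      \<le> (\<Sum>r\<in>F. \<bar>xi p phi t r\<bar> + (\<Sum>l = 1..q. \<bar>xi p phi t (r + int l)\<bar> * b l))"
  proof (rule sum_mono)
    fix r
    have "\<bar>\<Sum>l = 1..q. xi p phi t (r + int l) * theta l (r + int l)\<bar>
        \<le> (\<Sum>l = 1..q. \<bar>xi p phi t (r + int l)\<bar> * b l)"
      by (intro order.trans[OF sum_abs] sum_mono) (auto simp: abs_mult intro!: mult_left_mono theta)
    then show "\<bar>xi_q p q phi theta t r\<bar>
        \<le> \<bar>xi p phi t r\<bar> + (\<Sum>l = 1..q. \<bar>xi p phi t (r + int l)\<bar> * b l)"
      unfolding xi_q_def by linarith
  qed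
  also have "\<dots> = (\<Sum>r\<in>F. \<bar>xi p phi t r\<bar>) + (\<Sum>l = 1..q. (\<Sum>r\<in>F. \<bar>xi p phi t (r + int l)\<bar>) * b l)"
    by (simp add: sum.distrib sum_distrib_right sum.swap[of _ _ F])
  also have "\<dots> \<le> C + (\<Sum>l = 1..q. C * b l)"
  proof (intro add_mono sum_mono mult_right_mono)
    fix l assume l: "l \<in> {1..q}"
    have "(\<Sum>r\<in>F. \<bar>xi p phi t (r + int l)\<bar>) = (\<Sum>r\<in>(\<lambda>r. r + int l) ` F. \<bar>xi p phi t r\<bar>)"
      by (simp add: sum.reindex inj_on_def)
    also have "\<dots> \<le> C"
      using \<open>finite F\<close> by (intro xi) simp
    finally show "(\<Sum>r\<in>F. \<bar>xi p phi t (r + int l)\<bar>) \<le> C" .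
    \<comment> \<open>A bound on an absolute value is nonnegative, so multiplying by it preserves
      the inequality.\<close>
    show "0 \<le> b l"
      using theta[OF l] abs_ge_zero order.trans by blast
  qed (use xi \<open>finite F\<close> in blast)
  also have "\<dots> = C * (1 + (\<Sum>l = 1..q. b l))"
    by (simp add: distrib_left sum_distrib_left)
  finally show ?thesis .
qed

lemma (in tv_arma) MSE_eq:
  "MSE M p q phi theta eps t s = (\<Sum>r = s + 1..t. (xi_q p q phi theta t r)\<^sup>2 * sigma2 r)"
  unfolding MSE_def forecast_error_def[abs_def]
  using eps_measurable eps_square_integrable eps_mean eps_uncorrelated
  by (subst variance_sum_uncorrelated) (auto simp: eps_variance)

theorem corollary3:
  fixes M :: "'a measure" and p q :: nat
    and drift sigma2 :: "int \<Rightarrow> real"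
    and phi theta :: "nat \<Rightarrow> int \<Rightarrow> real"
    and y eps :: "int \<Rightarrow> 'a \<Rightarrow> real"
    and C :: real
  assumes "tv_arma M p q drift phi theta sigma2 y eps"
    and "C > 1"
    and "\<And>t. (\<lambda>r. \<bar>xi p phi t r\<bar>) summable_on {..t}"
    and "\<And>t. (\<Sum>\<^sub>\<infinity>r\<in>{..t}. \<bar>xi p phi t r\<bar>) \<le> C"
  shows "(\<forall>t s. s < t \<longrightarrow>
            MSE M p q phi theta eps t s
              = (\<Sum>r = s + 1..t. (xi_q p q phi theta t r)\<^sup>2 * sigma2 r))
         \<and> (\<exists>B. \<forall>t s. s < t \<longrightarrow> \<bar>MSE M p q phi theta eps t s\<bar> \<le> B)"
proof -
  interpret tv_arma M p q drift phi theta sigma2 y eps by fact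
  obtain K where K: "\<And>r. sigma2 r \<le> K"
    using sigma2_bounded by blast
  have "\<exists>b. \<forall>l\<in>{1..q}. \<forall>r. \<bar>theta l r\<bar> \<le> b l"
    using theta_bounded by (intro bchoice) (auto simp: bounded_iff)
  then obtain b where b: "\<And>l r. l \<in> {1..q} \<Longrightarrow> \<bar>theta l r\<bar> \<le> b l"
    by blast
  \<comment> \<open>This bounds the l1 norm of \<open>xi_q\<close> and depends on neither
    \<open>t\<close> nor \<open>s\<close>, which makes \<open>D\<^sup>2 * K\<close> a uniform
    bound.\<close>
  define D where "D = C * (1 + (\<Sum>l = 1..q. b l))"
  have "\<bar>MSE M p q phi theta eps t s\<bar> \<le> D\<^sup>2 * K" for t s
  proof -
    have "(\<Sum>r\<in>F. \<bar>xi p phi t r\<bar>) \<le> C" if "finite F" for F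
      using sum_abs_xi_le[OF assms(3) that] assms(4) by (rule order.trans)
    then have D: "(\<Sum>r = s + 1..t. \<bar>xi_q p q phi theta t r\<bar>) \<le> D"
      unfolding D_def by (intro sum_abs_xi_q_le b) auto
    have "\<bar>MSE M p q phi theta eps t s\<bar> = (\<Sum>r = s + 1..t. (xi_q p q phi theta t r)\<^sup>2 * sigma2 r)"
      unfolding MSE_eq using sigma2_pos by (simp add: sum_nonneg less_imp_le)
    also have "\<dots> \<le> (\<Sum>r = s + 1..t. (xi_q p q phi theta t r)\<^sup>2) * K"
      unfolding sum_distrib_right by (intro sum_mono mult_left_mono K) auto
    also have "\<dots> \<le> D\<^sup>2 * K"
    proof (rule mult_right_mono)
      show "(\<Sum>r = s + 1..t. (xi_q p q phi theta t r)\<^sup>2) \<le> D\<^sup>2"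
        by (rule order.trans[OF sum_squares_le_square_sum_abs power_mono[OF D]]) (simp add: sum_nonneg)
      \<comment> \<open>\<open>K\<close> lies above a positive variance; time 0 is an arbitrary
        choice.\<close>
      show "0 \<le> K"
        using K[of 0] sigma2_pos[of 0] by linarith
    qed
    finally show ?thesis .
  qed
  then show ?thesis
    using MSE_eq by blast
qed

end
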